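(* Let $A$ be a finite or countably infinite set, let $P_a=(p_{a,k})_{k\ge1}$, $a\in A$, be probability distributions on $\mathbb N_+$, and let $Z=(Z_n)_{n\ge1}=((X_n,K_n))_{n\ge1}$ be the regime switching process on $A\times\mathbb N_+$ with these letter distributions and with an arbitrary underlying $A$-valued process $X$. For any $n\ge1$ and any $0\le r\le n-1$, $$\mathbf P\{\mathcal L_n=r\}\le\mathbf P\{L_n=r\}\,\sup_{a\in A}\sum_{k=1}^{\infty}p_{a,k}^{1+r}+\inf_{0\le\varepsilon\le1}\left\{a^{n,r}(\varepsilon)+b^{n,r}(\varepsilon)\right\},$$ where $$a^{n,r}(\varepsilon)=c(r)\,\mathbf E\left[\mathbf 1\{L_n>r\}\frac{\nu(X_{n+1},\varepsilon)}{L_n}\right],$$ $$b^{n,r}(\varepsilon)=2^{1+r}\int_0^\varepsilon u^r\,\mathbf E\left[\mathbf 1\{L_n>r\}\,\nu\left(X_{n+1},\frac u2\right)\binom{L_n}{r}\left(1-\frac u2\right)^{L_n-r}\right]du,$$ and $c(0)=e^{-1}$, $c(r)=e(1+r)/\sqrt\pi$ for $r\ge1$ (here $\pi=3.14159\ldots$).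
   Context: $\mathbb N_+=\{1,2,\dots\}$. Regime switching process: let $R=\{R_n\}_{n\ge1}$ be the family of conditional distributions of an arbitrary discrete time process on $A$, i.e. $R_1$ is a distribution on $A$ and $R_n(\cdot\mid a_1,\dots,a_{n-1})$, $n\ge2$, is the conditional distribution of the $n$-th value given the first $n-1$ values. $Z$ is the process on $A\times\mathbb N_+$ with $\mathbf P\{Z_1=(a,k)\}=R_1(a)p_{a,k}$ and, for $n\ge2$, $\mathbf P\{Z_n=(a_n,k_n)\mid Z_1=(a_1,k_1),\dots,Z_{n-1}=(a_{n-1},k_{n-1})\}=R_n(a_n\mid a_1,\dots,a_{n-1})\,p_{a_n,k_n}$. Write $Z_n=(X_n,K_n)$; $X$ is called the underlying process. Set $$\mathcal L_n=\sum_{i=1}^n\mathbf 1\{Z_i=Z_{n+1}\},\qquad L_n=\sum_{i=1}^n\mathbf 1\{X_i=X_{n+1}\}.$$ The counting function of $P_a$ is $\nu(a,\varepsilon)=\sum_{k\ge1}\mathbf 1\{p_{a,k}\ge\varepsilon\}$, $0\le\varepsilon\le1$ (values in $[0,\infty]$; the quantities $a^{n,r}(\varepsilon),b^{n,r}(\varepsilon)$ may be $+\infty$). *)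

theory Defs
  imports "HOL-Probability.Probability"
begin

text \<open>
  The process \<open>Z\<close> is indexed by \<open>1, 2, \<dots>\<close>; its value at index \<open>0\<close> is never used. The law \<open>P a\<close> on
  the positive integers is a pmf on \<open>nat\<close> without mass at \<open>0\<close>, so that \<open>p\<^sub>a\<^sub>,\<^sub>k\<close> is \<open>pmf (P a) k\<close>.
  The family \<open>R\<^sub>n(\<cdot> | a\<^sub>1, \<dots>, a\<^sub>n\<^sub>-\<^sub>1)\<close> is the single kernel \<open>R [a\<^sub>1, \<dots>, a\<^sub>n\<^sub>-\<^sub>1]\<close>, with \<open>R\<^sub>1 = R []\<close>.
  Conditional probabilities are prescribed only for histories of nonzero probability.
\<close>

locale regime_switching_process = prob_space M
  for M :: "'w measure" +
  fixes A :: "'a set"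
    and P :: "'a \<Rightarrow> nat pmf"
    and R :: "'a list \<Rightarrow> 'a pmf"
    and Z :: "nat \<Rightarrow> 'w \<Rightarrow> 'a \<times> nat"
  assumes countable_alphabet: "countable A"
    and letter_support: "\<And>a. a \<in> A \<Longrightarrow> set_pmf (P a) \<subseteq> {1..}"
    and underlying_support: "\<And>as. set as \<subseteq> A \<Longrightarrow> set_pmf (R as) \<subseteq> A"
    and Z_measurable: "\<And>n. 1 \<le> n \<Longrightarrow> Z n \<in> M \<rightarrow>\<^sub>M count_space (A \<times> {1..})"
    and Z_initial: "\<And>a k. a \<in> A \<Longrightarrow> 1 \<le> k \<Longrightarrow>
      \<P>(w in M. Z 1 w = (a, k)) = pmf (R []) a * pmf (P a) k"
    and Z_transition: "\<And>n z a k. 2 \<le> n \<Longrightarrow> (\<And>i. i \<in> {1..<n} \<Longrightarrow> z i \<in> A \<times> {1..}) \<Longrightarrow>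
      a \<in> A \<Longrightarrow> 1 \<le> k \<Longrightarrow>
      \<P>(w in M. \<forall>i\<in>{1..<n}. Z i w = z i) \<noteq> 0 \<Longrightarrow>
      \<P>(w in M. Z n w = (a, k) \<bar> \<forall>i\<in>{1..<n}. Z i w = z i) =
        pmf (R (map (\<lambda>i. fst (z i)) [1..<n])) a * pmf (P a) k"

definition underlying :: "(nat \<Rightarrow> 'w \<Rightarrow> 'a \<times> nat) \<Rightarrow> nat \<Rightarrow> 'w \<Rightarrow> 'a" where
  "underlying Z n w = fst (Z n w)"

text \<open>
  \<open>occurrences Z n\<close> and \<open>occurrences (underlying Z) n\<close> are \<open>\<L>\<^sub>n\<close> and \<open>L\<^sub>n\<close>, respectively.
\<close>

definition occurrences :: "(nat \<Rightarrow> 'w \<Rightarrow> 'c) \<Rightarrow> nat \<Rightarrow> 'w \<Rightarrow> nat" where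
  "occurrences Y n w = (\<Sum>i = 1..n. of_bool (Y i w = Y (n + 1) w))"

text \<open>Infinite sums over \<open>k \<ge> 1\<close> are written with summation index \<open>Suc k\<close>.\<close>

definition counting_function :: "('a \<Rightarrow> nat pmf) \<Rightarrow> 'a \<Rightarrow> real \<Rightarrow> ennreal" where
  "counting_function P a \<epsilon> = (\<Sum>k. of_bool (pmf (P a) (Suc k) \<ge> \<epsilon>))"

definition c_const :: "nat \<Rightarrow> real" where
  "c_const r = (if r = 0 then exp (- 1) else exp 1 * (1 + real r) / sqrt pi)"

definition a_term ::
  "'w measure \<Rightarrow> ('a \<Rightarrow> nat pmf) \<Rightarrow> (nat \<Rightarrow> 'w \<Rightarrow> 'a) \<Rightarrow> nat \<Rightarrow> nat \<Rightarrow> real \<Rightarrow> ennreal" where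
  "a_term M P X n r \<epsilon> =
     ennreal (c_const r) *
     (\<integral>\<^sup>+w. of_bool (occurrences X n w > r) *
        (counting_function P (X (n + 1) w) \<epsilon> / of_nat (occurrences X n w)) \<partial>M)"

definition b_term ::
  "'w measure \<Rightarrow> ('a \<Rightarrow> nat pmf) \<Rightarrow> (nat \<Rightarrow> 'w \<Rightarrow> 'a) \<Rightarrow> nat \<Rightarrow> nat \<Rightarrow> real \<Rightarrow> ennreal" where
  "b_term M P X n r \<epsilon> =
     2 ^ (1 + r) *
     (\<integral>\<^sup>+u\<in>{0..\<epsilon>}. ennreal (u ^ r) *
        (\<integral>\<^sup>+w. of_bool (occurrences X n w > r) * counting_function P (X (n + 1) w) (u / 2) *
           of_nat (occurrences X n w choose r) *
           ennreal ((1 - u / 2) ^ (occurrences X n w - r)) \<partial>M) \<partial>lborel)"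

end

theory Submission
  imports Defs
begin

text \<open>
  Given \<open>X\<^sub>1, \<dots>, X\<^sub>n\<^sub>+\<^sub>1\<close>, the \<open>K\<^sub>i\<close> are independent with laws \<open>P (X\<^sub>i)\<close>. Hence, with \<open>a = X\<^sub>n\<^sub>+\<^sub>1\<close> and
  \<open>m = L\<^sub>n\<close>, the conditional probability of \<open>\<L>\<^sub>n = r\<close> is the sum over \<open>k\<close> of
  \<open>binom m r * p ^ (1 + r) * (1 - p) ^ (m - r)\<close> with \<open>p = p\<^sub>a\<^sub>,\<^sub>k\<close>. It vanishes for \<open>m < r\<close> and is
  the power sum of \<open>P a\<close> for \<open>m = r\<close>. For \<open>m > r\<close> each summand is at most \<open>c(r) / m\<close>, which is
  used when \<open>p \<ge> \<epsilon>\<close>; a summand with \<open>p < \<epsilon>\<close> is at most the contribution of \<open>k\<close> to the integral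
  in \<open>b\<^sup>n\<^sup>,\<^sup>r(\<epsilon>)\<close>, where \<open>\<nu>(a, u / 2)\<close> counts \<open>k\<close> as soon as \<open>u \<le> 2 * p\<close>.
\<close>

section \<open>Bounds for a single binomial weight and for the sum of these weights over k\<close>

text \<open>For \<open>r = 0\<close> this is \<open>x * exp (- x) \<le> exp (- 1)\<close> at \<open>x = m * p\<close>; for \<open>r \<ge> 1\<close> the left-hand side is
  \<open>(r + 1) / (m + 1)\<close> times a binomial probability, and \<open>exp 1 \<ge> sqrt pi\<close>.\<close>

lemma binomial_weight_le_c_const:
  fixes p :: real
  assumes p: "0 \<le> p" "p \<le> 1" and "r < m"
  shows "real (m choose r) * p ^ (1 + r) * (1 - p) ^ (m - r) \<le> c_const r / real m"
proof (cases "r = 0")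
  case True
  have "real m * p * (1 - p) ^ m \<le> real m * p * exp (- (real m * p))"
  proof -
    have "(1 - p) ^ m \<le> exp (- p) ^ m"
      using p exp_ge_add_one_self[of "- p"] by (intro power_mono) auto
    also have "\<dots> = exp (- (real m * p))"
      by (simp flip: exp_of_nat_mult)
    finally show ?thesis
      using p by (intro mult_left_mono) auto
  qed
  also have "\<dots> \<le> exp (real m * p - 1) * exp (- (real m * p))"
    using exp_ge_add_one_self[of "real m * p - 1"] by (intro mult_right_mono) auto
  also have "\<dots> = exp (- 1)"
    by (simp flip: exp_add)
  finally show ?thesis
    using True \<open>r < m\<close> by (simp add: c_const_def field_simps)
next
  case False
  have "real (Suc m) * real (m choose r) = real (Suc r) * real (Suc m choose Suc r)"
    using Suc_times_binomial_eq[of m r] by (metis mult.commute of_nat_mult)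
  then have "real (Suc m) * (real (m choose r) * p ^ (1 + r) * (1 - p) ^ (m - r)) =
      real (Suc r) * pmf (binomial_pmf (Suc m) p) (Suc r)"
    using p \<open>r < m\<close> by (simp add: mult_ac)
  also have "\<dots> \<le> real (Suc r)"
    by (intro mult_right_le_one_le) (auto simp: pmf_le_1 simp del: pmf_binomial)
  finally have *: "real (Suc m) * (real (m choose r) * p ^ (1 + r) * (1 - p) ^ (m - r)) \<le> real (Suc r)" .
  have "real m * (real (m choose r) * p ^ (1 + r) * (1 - p) ^ (m - r)) \<le>
      real (Suc m) * (real (m choose r) * p ^ (1 + r) * (1 - p) ^ (m - r))"
    using p by (intro mult_right_mono mult_nonneg_nonneg) auto
  also note *
  also have "real (Suc r) \<le> c_const r"
  proof -
    have "sqrt pi \<le> exp 1"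
      using real_sqrt_le_mono[of pi 4] pi_less_4 exp_ge_add_one_self[of 1] by simp
    then have "real (Suc r) * sqrt pi \<le> real (Suc r) * exp 1"
      by (intro mult_left_mono) auto
    then show ?thesis
      using False by (simp add: c_const_def field_simps)
  qed
  finally show ?thesis
    using \<open>r < m\<close> by (simp add: field_simps)
qed

lemma c_const_nonneg: "0 \<le> c_const r"
  by (simp add: c_const_def)

text \<open>Integrating over \<open>u \<in> [p / 2, p]\<close> alone suffices: there \<open>u\<^sup>r \<ge> (p / 2)\<^sup>r\<close>,
  and \<open>(p / 2)\<^sup>r\<^sup>+\<^sup>1\<close> accounts for the factor \<open>2\<^sup>1\<^sup>+\<^sup>r\<close>.\<close>

lemma power_weight_le_integral:
  fixes p \<epsilon> :: real
  assumes p: "0 \<le> p" "p < \<epsilon>" "\<epsilon> \<le> 1"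
  shows "ennreal (C * p ^ (1 + r) * (1 - p) ^ s) \<le> 2 ^ (1 + r) *
    (\<integral>\<^sup>+u\<in>{0..\<epsilon>}. ennreal (u ^ r) * of_bool (p \<ge> u / 2) * ennreal C * ennreal ((1 - u / 2) ^ s) \<partial>lborel)"
proof (cases "0 \<le> C")
  case False
  then have "C * p ^ (1 + r) * (1 - p) ^ s \<le> 0"
    using p by (intro mult_nonpos_nonneg) auto
  then show ?thesis by (simp add: ennreal_neg)
next
  case True
  define D where "D = (p / 2) ^ r * C * (1 - p) ^ s"
  have D: "0 \<le> D" "0 \<le> p / 2"
    using p True by (auto simp: D_def)
  have "C * p ^ (1 + r) * (1 - p) ^ s = 2 ^ (1 + r) * (D * (p / 2))"
    by (simp add: power_divide D_def)
  also have "ennreal \<dots> = ennreal (2 ^ (1 + r)) * (ennreal D * ennreal (p / 2))"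
    using D by (simp only: ennreal_mult mult_nonneg_nonneg zero_le_power zero_le_numeral)
  also have "ennreal (2 ^ (1 + r)) = 2 ^ (1 + r)"
    by (metis ennreal_numeral ennreal_power zero_le_numeral)
  also have "ennreal (p / 2) = emeasure lborel {p / 2..p}"
    using p by simp
  also have "ennreal D * emeasure lborel {p / 2..p} =
      (\<integral>\<^sup>+u. ennreal D * indicator {p / 2..p} u \<partial>lborel)"
    by (simp add: nn_integral_cmult_indicator)
  also have "\<dots> \<le> (\<integral>\<^sup>+u\<in>{0..\<epsilon>}. ennreal (u ^ r) * of_bool (p \<ge> u / 2) * ennreal C *
      ennreal ((1 - u / 2) ^ s) \<partial>lborel)"
  proof (rule nn_integral_mono)
    fix u :: real
    show "ennreal D * indicator {p / 2..p} u \<le>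
      ennreal (u ^ r) * of_bool (p \<ge> u / 2) * ennreal C * ennreal ((1 - u / 2) ^ s) * indicator {0..\<epsilon>} u"
    proof (cases "u \<in> {p / 2..p}")
      case u: True
      \<comment> \<open>For the last factor, \<open>u <= p\<close> gives
        \<open>1 - u / 2 >= 1 - p\<close>. The same inequality keeps \<open>u\<close> in the range
        of integration and makes \<open>of_bool (p >= u / 2)\<close> equal to 1.\<close>
      then have "D \<le> u ^ r * C * (1 - u / 2) ^ s"
        unfolding D_def using p True by (intro mult_mono power_mono mult_nonneg_nonneg) auto
      then have "ennreal D \<le> ennreal (u ^ r * C * (1 - u / 2) ^ s)"
        by (rule ennreal_leI)
      then show ?thesis
        using u p True by (simp add: ennreal_mult)
    qed simp
  qed
  finally show ?thesis
    by (simp add: mult_left_mono)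
qed

text \<open>Each k is charged to \<open>c_const r / m\<close> if its probability is at least
  \<epsilon>, and otherwise to the integral from \<open>power_weight_le_integral\<close>. The
  integral is kept for all k, which only enlarges the right-hand side. Summed over k, the indicators
  become counting functions, the one at \<open>u / 2\<close> after interchanging sum and
  integral.\<close>

lemma suminf_binomial_weight_le:
  assumes "r < m" "0 \<le> \<epsilon>" "\<epsilon> \<le> 1"
  shows "(\<Sum>k. ennreal (real (m choose r) * pmf (P a) (Suc k) ^ (1 + r) * (1 - pmf (P a) (Suc k)) ^ (m - r))) \<le>
    ennreal (c_const r) * (counting_function P a \<epsilon> / of_nat m) +
    2 ^ (1 + r) * (\<integral>\<^sup>+u\<in>{0..\<epsilon>}. ennreal (u ^ r) *
      (counting_function P a (u / 2) * of_nat (m choose r) * ennreal ((1 - u / 2) ^ (m - r))) \<partial>lborel)"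
proof -
  define p where "p k = pmf (P a) (Suc k)" for k
  have p: "0 \<le> p k" "p k \<le> 1" for k
    by (auto simp: p_def pmf_le_1)
  define I where "I k = (\<integral>\<^sup>+u\<in>{0..\<epsilon>}. ennreal (u ^ r) * of_bool (p k \<ge> u / 2) * ennreal (real (m choose r)) *
      ennreal ((1 - u / 2) ^ (m - r)) \<partial>lborel)" for k
  have "(\<Sum>k. ennreal (real (m choose r) * p k ^ (1 + r) * (1 - p k) ^ (m - r))) \<le>
      (\<Sum>k. ennreal (c_const r / real m) * of_bool (p k \<ge> \<epsilon>) + 2 ^ (1 + r) * I k)"
  proof (intro suminf_le allI)
    fix k
    show "ennreal (real (m choose r) * p k ^ (1 + r) * (1 - p k) ^ (m - r)) \<le>
      ennreal (c_const r / real m) * of_bool (p k \<ge> \<epsilon>) + 2 ^ (1 + r) * I k"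
    proof (cases "p k \<ge> \<epsilon>")
      case True
      then show ?thesis
        using ennreal_leI[OF binomial_weight_le_c_const[OF p[of k] \<open>r < m\<close>]]
        by (simp add: add_increasing2)
    next
      case False
      then show ?thesis
        using power_weight_le_integral[of "p k" \<epsilon> "real (m choose r)" r "m - r"] p[of k] \<open>\<epsilon> \<le> 1\<close>
        by (simp add: I_def)
    qed
  qed auto
  also have "\<dots> = ennreal (c_const r / real m) * counting_function P a \<epsilon> + 2 ^ (1 + r) * (\<Sum>k. I k)"
    by (simp add: suminf_add[symmetric] counting_function_def p_def)
  also have "ennreal (c_const r / real m) * counting_function P a \<epsilon> =
      ennreal (c_const r) * (counting_function P a \<epsilon> / of_nat m)"
    using \<open>r < m\<close> c_const_nonneg[of r]
    by (simp add: divide_ennreal[symmetric] ennreal_of_nat_eq_real_of_nat divide_ennreal_def mult_ac)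
  also have "(\<Sum>k. I k) = (\<integral>\<^sup>+u\<in>{0..\<epsilon>}. ennreal (u ^ r) *
      (counting_function P a (u / 2) * of_nat (m choose r) * ennreal ((1 - u / 2) ^ (m - r))) \<partial>lborel)"
  proof -
    have "(\<Sum>k. I k) = (\<integral>\<^sup>+u. (\<Sum>k. ennreal (u ^ r) * of_bool (p k \<ge> u / 2) * ennreal (real (m choose r)) *
      ennreal ((1 - u / 2) ^ (m - r)) * indicator {0..\<epsilon>} u) \<partial>lborel)"
      unfolding I_def by (subst nn_integral_suminf) auto
    also have "\<dots> = (\<integral>\<^sup>+u\<in>{0..\<epsilon>}. ennreal (u ^ r) *
      (counting_function P a (u / 2) * of_nat (m choose r) * ennreal ((1 - u / 2) ^ (m - r))) \<partial>lborel)"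
    proof (rule nn_integral_cong)
      fix u
      have "(\<Sum>k. ennreal (u ^ r) * of_bool (p k \<ge> u / 2) * ennreal (real (m choose r)) *
          ennreal ((1 - u / 2) ^ (m - r)) * indicator {0..\<epsilon>} u) =
        (\<Sum>k. (ennreal (u ^ r) * ennreal (real (m choose r)) * ennreal ((1 - u / 2) ^ (m - r)) *
          indicator {0..\<epsilon>} u) * of_bool (p k \<ge> u / 2))"
        by (simp only: mult_ac)
      also have "\<dots> = (ennreal (u ^ r) * ennreal (real (m choose r)) * ennreal ((1 - u / 2) ^ (m - r)) *
          indicator {0..\<epsilon>} u) * (\<Sum>k. of_bool (p k \<ge> u / 2))"
        by (rule ennreal_suminf_cmult)
      also have "\<dots> = ennreal (u ^ r) * (counting_function P a (u / 2) * of_nat (m choose r) *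
          ennreal ((1 - u / 2) ^ (m - r))) * indicator {0..\<epsilon>} u"
        by (simp only: counting_function_def p_def ennreal_of_nat_eq_real_of_nat mult_ac)
      finally show "(\<Sum>k. ennreal (u ^ r) * of_bool (p k \<ge> u / 2) * ennreal (real (m choose r)) *
          ennreal ((1 - u / 2) ^ (m - r)) * indicator {0..\<epsilon>} u) =
        ennreal (u ^ r) * (counting_function P a (u / 2) * of_nat (m choose r) *
          ennreal ((1 - u / 2) ^ (m - r))) * indicator {0..\<epsilon>} u" .
    qed
    finally show ?thesis .
  qed
  finally show ?thesis
    by (simp add: p_def)
qed

section \<open>Discrete integrals, and the law of the number of matches given the letters\<close>

text \<open>The law of \<open>W\<close> is a density with respect to counting measure, as can be
  checked on singletons. This turns expectations into sums over the values of \<open>W\<close>, for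
  arbitrary \<open>f\<close>.\<close>

lemma nn_integral_countable_range:
  assumes S: "countable S" and W: "W \<in> M \<rightarrow>\<^sub>M count_space S"
  shows "(\<integral>\<^sup>+w. f (W w) \<partial>M) = (\<integral>\<^sup>+s. emeasure M (W -` {s} \<inter> space M) * f s \<partial>count_space S)"
proof -
  have "(\<integral>\<^sup>+w. f (W w) \<partial>M) = (\<integral>\<^sup>+s. f s \<partial>distr M (count_space S) W)"
    using W by (simp add: nn_integral_distr)
  also have "distr M (count_space S) W =
      density (count_space S) (\<lambda>s. emeasure M (W -` {s} \<inter> space M))"
    by (rule measure_eqI_countable[of _ S])
      (use S W in \<open>auto simp: emeasure_distr emeasure_density nn_integral_count_space_indicator
          indicator_inter_arith[symmetric] one_ennreal_def[symmetric] split: split_indicator\<close>)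
  also have "(\<integral>\<^sup>+s. f s \<partial>\<dots>) = (\<integral>\<^sup>+s. emeasure M (W -` {s} \<inter> space M) * f s \<partial>count_space S)"
    by (simp add: nn_integral_density)
  finally show ?thesis .
qed

text \<open>The events \<open>f j = k\<close> are independent and all have probability
  \<open>pmf q k\<close>. In the application \<open>J\<close> consists of the indices that carry one
  fixed letter, so that the laws agree on \<open>J\<close>.\<close>

lemma map_pmf_card_eq_Pi_pmf:
  assumes "finite J" and q: "\<And>j. j \<in> J \<Longrightarrow> p j = q"
  shows "map_pmf (\<lambda>f. card {j\<in>J. f j = k}) (Pi_pmf J d p) = binomial_pmf (card J) (pmf q k)"
proof -
  have "map_pmf (\<lambda>y. y = k) q = bernoulli_pmf (pmf q k)"
  proof (rule pmf_eqI)
    fix b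
    have *: "pmf (map_pmf (\<lambda>y. y = k) q) True = pmf q k"
      by (simp add: pmf_map vimage_def measure_pmf_single)
    then have "pmf (map_pmf (\<lambda>y. y = k) q) False = 1 - pmf q k"
      using pmf_False_conv_True by metis
    with * show "pmf (map_pmf (\<lambda>y. y = k) q) b = pmf (bernoulli_pmf (pmf q k)) b"
      by (cases b) (simp_all add: pmf_le_1)
  qed
  \<comment> \<open>The default of the Boolean product is \<open>d = k\<close>, the image of
    \<open>d\<close>, as \<open>Pi_pmf_map\<close> requires.\<close>
  then have "binomial_pmf (card J) (pmf q k) =
      map_pmf (\<lambda>f. card {j\<in>J. f j}) (Pi_pmf J (d = k) (\<lambda>_. map_pmf (\<lambda>y. y = k) q))"
    using \<open>finite J\<close> by (subst binomial_pmf_altdef'[of J _ _ "d = k"]) (auto simp: pmf_le_1)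
  also have "\<dots> = map_pmf (\<lambda>f. card {j\<in>J. f j = k}) (Pi_pmf J d (\<lambda>_. q))"
    using \<open>finite J\<close> by (simp add: Pi_pmf_map[of J "\<lambda>y. y = k" d] map_pmf_comp)
  also have "Pi_pmf J d (\<lambda>_. q) = Pi_pmf J d p"
    using q by (intro Pi_pmf_cong) auto
  finally show ?thesis ..
qed

lemma sum_of_bool_eq_card: "finite J \<Longrightarrow> (\<Sum>j\<in>J. of_bool (Q j)) = card {j\<in>J. Q j}"
  by (simp add: Int_def)

text \<open>Draw the number at index n + 1 first. If it is k, the matches are those of the m indices
  with the same letter whose number is also k, so their count is binomial. Averaging over k
  contributes one more factor p, hence the exponent 1 + r; \<open>P0\<close> removes the term k =
  0.\<close>

lemma nn_integral_Pi_pmf_occurrences: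
  fixes x :: "nat \<Rightarrow> 'a" and P :: "'a \<Rightarrow> nat pmf"
  assumes m: "m = occurrences (\<lambda>i y. y i) n x" and P0: "pmf (P (x (n + 1))) 0 = 0"
  shows "(\<integral>\<^sup>+\<kappa>. of_bool ((\<Sum>i = 1..n. of_bool (x i = x (n + 1) \<and> \<kappa> i = \<kappa> (n + 1))) = r)
      \<partial>Pi_pmf {1..n + 1} d (\<lambda>i. P (x i))) =
    (\<Sum>k. ennreal (real (m choose r) * pmf (P (x (n + 1))) (Suc k) ^ (1 + r) *
      (1 - pmf (P (x (n + 1))) (Suc k)) ^ (m - r)))"
proof -
  define a where "a = x (n + 1)"
  define J where "J = {i\<in>{1..n}. x i = a}"
  have cardJ: "card J = m"
    unfolding m occurrences_def J_def a_def by (subst sum_of_bool_eq_card) auto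
  have "{1..n + 1} = insert (n + 1) {1..n}"
    by auto
  then have "Pi_pmf {1..n + 1} d (\<lambda>i. P (x i)) =
      do {k \<leftarrow> P a; f \<leftarrow> Pi_pmf {1..n} d (\<lambda>i. P (x i)); return_pmf (f(n + 1 := k))}"
    by (simp add: Pi_pmf_insert' a_def)
  then have "(\<integral>\<^sup>+\<kappa>. of_bool ((\<Sum>i = 1..n. of_bool (x i = x (n + 1) \<and> \<kappa> i = \<kappa> (n + 1))) = r)
      \<partial>Pi_pmf {1..n + 1} d (\<lambda>i. P (x i))) =
    (\<integral>\<^sup>+k. \<integral>\<^sup>+f. of_bool ((\<Sum>i = 1..n. of_bool (x i = x (n + 1) \<and> (f(n + 1 := k)) i = (f(n + 1 := k)) (n + 1))) = r)
      \<partial>Pi_pmf {1..n} d (\<lambda>i. P (x i)) \<partial>P a)"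
    by (simp del: sum_of_bool_eq fun_upd_apply)
  also have "\<dots> = (\<integral>\<^sup>+k. ennreal (pmf (binomial_pmf m (pmf (P a) k)) r) \<partial>P a)"
  proof (rule nn_integral_cong)
    fix k
    have sum: "(\<Sum>i = 1..n. of_bool (x i = x (n + 1) \<and> (f(n + 1 := k)) i = (f(n + 1 := k)) (n + 1))) =
        card {j\<in>J. (if j \<in> J then f j else d) = k}" for f :: "nat \<Rightarrow> nat"
    proof -
      have "(\<Sum>i = 1..n. of_bool (x i = x (n + 1) \<and> (f(n + 1 := k)) i = (f(n + 1 := k)) (n + 1))) =
        card {i\<in>{1..n}. x i = x (n + 1) \<and> (f(n + 1 := k)) i = (f(n + 1 := k)) (n + 1)}"
        by (rule sum_of_bool_eq_card) simp
      also have "\<dots> = card {j\<in>J. (if j \<in> J then f j else d) = k}"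
        by (rule arg_cong[where f = card]) (auto simp: J_def a_def)
      finally show ?thesis .
    qed
    have "binomial_pmf m (pmf (P a) k) =
        map_pmf (\<lambda>f. card {j\<in>J. f j = k}) (Pi_pmf J d (\<lambda>i. P (x i)))"
      unfolding cardJ[symmetric] by (rule map_pmf_card_eq_Pi_pmf[symmetric]) (auto simp: J_def)
    \<comment> \<open>Numbers outside \<open>J\<close> do not affect the count: the product law on
      \<open>J\<close> is a marginal of the one on \<open>{1..n}\<close>.\<close>
    also have "Pi_pmf J d (\<lambda>i. P (x i)) =
        map_pmf (\<lambda>f j. if j \<in> J then f j else d) (Pi_pmf {1..n} d (\<lambda>i. P (x i)))"
      by (rule Pi_pmf_subset) (auto simp: J_def)
    finally have map: "binomial_pmf m (pmf (P a) k) = map_pmf (\<lambda>f. card {j\<in>J. f j = k})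
        (map_pmf (\<lambda>f j. if j \<in> J then f j else d) (Pi_pmf {1..n} d (\<lambda>i. P (x i))))" .
    have "ennreal (pmf (binomial_pmf m (pmf (P a) k)) r) =
        (\<integral>\<^sup>+j. indicator {r} j \<partial>binomial_pmf m (pmf (P a) k))"
      by (simp add: emeasure_pmf_single del: pmf_binomial)
    also have "\<dots> = (\<integral>\<^sup>+f. indicator {r} (card {j\<in>J. (if j \<in> J then f j else d) = k}) \<partial>Pi_pmf {1..n} d (\<lambda>i. P (x i)))"
      unfolding map by (simp only: nn_integral_map_pmf)
    finally have "ennreal (pmf (binomial_pmf m (pmf (P a) k)) r) =
        (\<integral>\<^sup>+f. indicator {r} (card {j\<in>J. (if j \<in> J then f j else d) = k}) \<partial>Pi_pmf {1..n} d (\<lambda>i. P (x i)))" .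
    then show "(\<integral>\<^sup>+f. of_bool ((\<Sum>i = 1..n. of_bool (x i = x (n + 1) \<and> (f(n + 1 := k)) i = (f(n + 1 := k)) (n + 1))) = r)
      \<partial>Pi_pmf {1..n} d (\<lambda>i. P (x i))) = ennreal (pmf (binomial_pmf m (pmf (P a) k)) r)"
      unfolding sum by (simp add: indicator_def of_bool_def)
  qed
  also have "\<dots> = (\<Sum>k. ennreal (pmf (P a) k) * ennreal (pmf (binomial_pmf m (pmf (P a) k)) r))"
    by (simp add: nn_integral_measure_pmf nn_integral_count_space_nat)
  also have "\<dots> = (\<Sum>k. ennreal (pmf (P a) (Suc k)) * ennreal (pmf (binomial_pmf m (pmf (P a) (Suc k))) r))"
    using P0 suminf_offset[of "\<lambda>k. ennreal (pmf (P a) k) * ennreal (pmf (binomial_pmf m (pmf (P a) k)) r)" 1]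
    by (simp add: a_def)
  also have "\<dots> = (\<Sum>k. ennreal (real (m choose r) * pmf (P a) (Suc k) ^ (1 + r) * (1 - pmf (P a) (Suc k)) ^ (m - r)))"
    by (intro suminf_cong) (simp add: ennreal_mult'[symmetric] pmf_le_1 mult_ac)
  finally show ?thesis
    by (simp add: a_def)
qed

section \<open>Probabilities of finite histories\<close>

lemma (in regime_switching_process) trajectory_event:
  assumes "\<And>i. i \<in> {1..N} \<Longrightarrow> z i \<in> A \<times> {1..}"
  shows "{w \<in> space M. \<forall>i\<in>{1..N}. Z i w = z i} \<in> events"
proof -
  have "Z i -` {z i} \<inter> space M \<in> events" if "i \<in> {1..N}" for i
    using assms[of i] that by (intro measurable_sets[OF Z_measurable]) auto
  then have "{w \<in> space M. Z i w = z i} \<in> events" if "i \<in> {1..N}" for i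
    using that by (simp add: vimage_def Int_def conj_commute)
  then show ?thesis
    by (intro sets.sets_Collect_finite_All) auto
qed

text \<open>Chain rule of conditional probability. The first factor comes from
  \<open>Z_initial\<close>, since \<open>Z_transition\<close> starts at index 2.\<close>

lemma (in regime_switching_process) prob_trajectory:
  assumes "\<And>i. i \<in> {1..N} \<Longrightarrow> z i \<in> A \<times> {1..}"
  shows "\<P>(w in M. \<forall>i\<in>{1..N}. Z i w = z i) =
    (\<Prod>i = 1..N. pmf (R (map (\<lambda>j. fst (z j)) [1..<i])) (fst (z i)) * pmf (P (fst (z i))) (snd (z i)))"
  using assms
proof (induction N)
  case 0
  then show ?case by (simp add: prob_space)
next
  case (Suc N)
  let ?h = "\<lambda>w. \<forall>i\<in>{1..N}. Z i w = z i"
  obtain a k where zN: "z (Suc N) = (a, k)" "a \<in> A" "1 \<le> k"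
    using Suc.prems[of "Suc N"] by (cases "z (Suc N)") auto
  have *: "(\<forall>i\<in>{1..Suc N}. Z i w = z i) \<longleftrightarrow> Z (Suc N) w = (a, k) \<and> ?h w" for w
    using zN by (simp add: atLeastAtMostSuc_conv)
  have "\<P>(w in M. \<forall>i\<in>{1..Suc N}. Z i w = z i) =
      pmf (R (map (\<lambda>i. fst (z i)) [1..<Suc N])) a * pmf (P a) k * \<P>(w in M. ?h w)"
  proof (cases "N = 0")
    case True
    then show ?thesis using Z_initial[of a k] zN by (simp add: prob_space)
  next
    case False
    show ?thesis
    proof (cases "\<P>(w in M. ?h w) = 0")
      \<comment> \<open>No conditional probability is prescribed after a null history, but its
        extensions are null as well and both sides vanish.\<close>
      case True
      have "\<P>(w in M. \<forall>i\<in>{1..Suc N}. Z i w = z i) \<le> \<P>(w in M. ?h w)"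
        using Suc.prems by (intro finite_measure_mono trajectory_event) auto
      with True show ?thesis by (simp add: measure_le_0_iff)
    next
      case nz: False
      have "{1..<Suc N} = {1..N}" by auto
      then have "\<P>(w in M. Z (Suc N) w = (a, k) \<bar> ?h w) =
          pmf (R (map (\<lambda>i. fst (z i)) [1..<Suc N])) a * pmf (P a) k"
        using Z_transition[of "Suc N" z a k] nz Suc.prems zN False by simp
      then show ?thesis
        using nz unfolding * cond_prob_def by (simp add: field_simps)
    qed
  qed
  also have "\<P>(w in M. ?h w) = (\<Prod>i = 1..N. pmf (R (map (\<lambda>j. fst (z j)) [1..<i])) (fst (z i)) *
      pmf (P (fst (z i))) (snd (z i)))"
    using Suc.prems by (intro Suc.IH) auto
  finally show ?case
    using zN by (simp add: mult_ac)
qed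

section \<open>Integration over trajectories: letters outside, numbers inside\<close>

context regime_switching_process
begin

text \<open>Letters and numbers are separate components, so that the numbers can be integrated out
  for fixed letters. Restriction to \<open>{1..N}\<close> leaves only countably many values.\<close>

definition trajectory :: "nat \<Rightarrow> 'w \<Rightarrow> (nat \<Rightarrow> 'a) \<times> (nat \<Rightarrow> nat)" where
  "trajectory N w = (\<lambda>i\<in>{1..N}. fst (Z i w), \<lambda>i\<in>{1..N}. snd (Z i w))"

definition letter_paths :: "nat \<Rightarrow> (nat \<Rightarrow> 'a) set" where
  "letter_paths N = {1..N} \<rightarrow>\<^sub>E A"

text \<open>For \<open>x\<close> in \<open>letter_paths N\<close> this is the probability that the
  underlying process follows \<open>x\<close> up to time N, by \<open>nn_integral_path\<close>
  applied to an indicator.\<close>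

definition path_weight :: "nat \<Rightarrow> (nat \<Rightarrow> 'a) \<Rightarrow> ennreal" where
  "path_weight N x = ennreal (\<Prod>i = 1..N. pmf (R (map x [1..<i])) (x i))"

text \<open>The conditional law of the numbers given the letters \<open>x\<close>. The default
  \<open>undefined\<close> matches the restricted functions in \<open>trajectory\<close>.\<close>

abbreviation letters_pmf :: "nat \<Rightarrow> (nat \<Rightarrow> 'a) \<Rightarrow> (nat \<Rightarrow> nat) pmf" where
  "letters_pmf N x \<equiv> Pi_pmf {1..N} undefined (\<lambda>i. P (x i))"

lemma countable_letter_paths: "countable (letter_paths N)"
  unfolding letter_paths_def by (intro countable_PiE) (auto simp: countable_alphabet)

lemma vimage_trajectory:
  assumes "x \<in> letter_paths N" "\<kappa> \<in> {1..N} \<rightarrow>\<^sub>E {1..}"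
  shows "trajectory N -` {(x, \<kappa>)} \<inter> space M = {w \<in> space M. \<forall>i\<in>{1..N}. Z i w = (x i, \<kappa> i)}"
proof -
  have "trajectory N w = (x, \<kappa>) \<longleftrightarrow> (\<forall>i\<in>{1..N}. Z i w = (x i, \<kappa> i))" for w
  proof
    assume "trajectory N w = (x, \<kappa>)"
    then have "(\<lambda>i\<in>{1..N}. fst (Z i w)) = x" "(\<lambda>i\<in>{1..N}. snd (Z i w)) = \<kappa>"
      by (auto simp: trajectory_def)
    then have "fst (Z i w) = x i" "snd (Z i w) = \<kappa> i" if "i \<in> {1..N}" for i
      using that by (metis restrict_apply')+
    then show "\<forall>i\<in>{1..N}. Z i w = (x i, \<kappa> i)"
      by (simp add: prod_eq_iff)
  next
    assume "\<forall>i\<in>{1..N}. Z i w = (x i, \<kappa> i)"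
    then show "trajectory N w = (x, \<kappa>)"
      using assms by (auto simp: trajectory_def letter_paths_def fun_eq_iff PiE_def extensional_def)
  qed
  then show ?thesis by auto
qed

text \<open>The target is countable, so it suffices that preimages of points are events.\<close>

lemma measurable_trajectory:
  "trajectory N \<in> M \<rightarrow>\<^sub>M count_space (letter_paths N \<times> ({1..N} \<rightarrow>\<^sub>E {1..}))"
proof (subst measurable_count_space_eq_countable, goal_cases)
  case 1
  show ?case
    by (intro countable_SIGMA countable_letter_paths countable_PiE) auto
next
  case 2
  have "Z i w \<in> A \<times> {1..}" if "i \<in> {1..N}" "w \<in> space M" for i w
    using measurable_space[OF Z_measurable] that by fastforce
  then have "fst (Z i w) \<in> A" "1 \<le> snd (Z i w)" if "i \<in> {1..N}" "w \<in> space M" for i w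
    using that by (fastforce simp: mem_Times_iff)+
  then have "trajectory N \<in> space M \<rightarrow> letter_paths N \<times> ({1..N} \<rightarrow>\<^sub>E {1..})"
    by (auto simp: trajectory_def letter_paths_def)
  moreover have "trajectory N -` {(x, \<kappa>)} \<inter> space M \<in> events"
    if "x \<in> letter_paths N" "\<kappa> \<in> {1..N} \<rightarrow>\<^sub>E {1..}" for x \<kappa>
    unfolding vimage_trajectory[OF that]
    by (rule trajectory_event) (use that in \<open>auto simp: letter_paths_def\<close>)
  ultimately show ?case by auto
qed

text \<open>The product in \<open>prob_trajectory\<close> splits into letter factors and number
  factors; the latter form a product law. This is the conditional independence of the numbers given
  the letters.\<close>

lemma emeasure_trajectory:
  assumes "x \<in> letter_paths N" "\<kappa> \<in> {1..N} \<rightarrow>\<^sub>E {1..}"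
  shows "emeasure M (trajectory N -` {(x, \<kappa>)} \<inter> space M) =
    path_weight N x * ennreal (pmf (letters_pmf N x) \<kappa>)"
proof -
  have "\<P>(w in M. \<forall>i\<in>{1..N}. Z i w = (x i, \<kappa> i)) =
    (\<Prod>i = 1..N. pmf (R (map x [1..<i])) (x i) * pmf (P (x i)) (\<kappa> i))"
    by (subst prob_trajectory) (use assms in \<open>auto simp: letter_paths_def\<close>)
  also have "\<dots> = (\<Prod>i = 1..N. pmf (R (map x [1..<i])) (x i)) * pmf (letters_pmf N x) \<kappa>"
    using assms(2) by (subst pmf_Pi') (auto simp: prod.distrib PiE_def extensional_def)
  finally show ?thesis
    unfolding vimage_trajectory[OF assms] emeasure_eq_measure path_weight_def
    by (simp add: ennreal_mult prod_nonneg)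
qed

text \<open>Disintegration along the letters: sum over the countable set of trajectories, then apply
  Tonelli to the product of two counting measures.\<close>

lemma nn_integral_trajectory:
  "(\<integral>\<^sup>+w. F (fst (trajectory N w)) (snd (trajectory N w)) \<partial>M) =
    (\<integral>\<^sup>+x. path_weight N x * (\<integral>\<^sup>+\<kappa>. F x \<kappa> \<partial>letters_pmf N x) \<partial>count_space (letter_paths N))"
proof -
  let ?K = "{1..N} \<rightarrow>\<^sub>E {1..} :: (nat \<Rightarrow> nat) set"
  have cK: "countable ?K"
    by (intro countable_PiE) auto
  interpret K: sigma_finite_measure "count_space ?K"
    using cK by (rule sigma_finite_measure_count_space_countable)
  let ?f = "\<lambda>(x, \<kappa>). path_weight N x * ennreal (pmf (letters_pmf N x) \<kappa>) * F x \<kappa>"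
  have "(\<integral>\<^sup>+w. F (fst (trajectory N w)) (snd (trajectory N w)) \<partial>M) =
    (\<integral>\<^sup>+s. emeasure M (trajectory N -` {s} \<inter> space M) * F (fst s) (snd s) \<partial>count_space (letter_paths N \<times> ?K))"
    using nn_integral_countable_range[OF _ measurable_trajectory, of N "\<lambda>s. F (fst s) (snd s)"]
      countable_letter_paths cK by auto
  also have "\<dots> = (\<integral>\<^sup>+s. ?f s \<partial>count_space (letter_paths N \<times> ?K))"
    by (intro nn_integral_cong) (auto simp: emeasure_trajectory)
  also have "\<dots> = (\<integral>\<^sup>+s. ?f s \<partial>(count_space (letter_paths N) \<Otimes>\<^sub>M count_space ?K))"
    by (simp only: pair_measure_countable[OF countable_letter_paths cK])
  also have "\<dots> = (\<integral>\<^sup>+x. \<integral>\<^sup>+\<kappa>. ?f (x, \<kappa>) \<partial>count_space ?K \<partial>count_space (letter_paths N))"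
    by (rule K.nn_integral_fst[symmetric]) (simp only: pair_measure_countable[OF countable_letter_paths cK] borel_measurable_count_space)
  also have "\<dots> = (\<integral>\<^sup>+x. path_weight N x * (\<integral>\<^sup>+\<kappa>. F x \<kappa> \<partial>letters_pmf N x) \<partial>count_space (letter_paths N))"
  proof (rule nn_integral_cong)
    fix x assume "x \<in> space (count_space (letter_paths N))"
    then have x: "x i \<in> A" if "i \<in> {1..N}" for i
      using that by (auto simp: letter_paths_def)
    \<comment> \<open>By \<open>letter_support\<close> the product law lives on \<open>?K\<close>,
      so the sum over \<open>?K\<close> is the full integral with respect to
      \<open>letters_pmf N x\<close>.\<close>
    have supp: "pmf (letters_pmf N x) \<kappa> = 0" if "\<kappa> \<notin> ?K" for \<kappa>
    proof (rule ccontr)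
      assume "pmf (letters_pmf N x) \<kappa> \<noteq> 0"
      then have "\<kappa> \<in> PiE_dflt {1..N} undefined (set_pmf \<circ> (\<lambda>i. P (x i)))"
        using set_Pi_pmf_subset'[of "{1..N}" undefined "\<lambda>i. P (x i)"] by (auto simp: set_pmf_iff)
      then have "\<kappa> \<in> ?K"
        using letter_support[OF x] by (fastforce simp: PiE_dflt_def PiE_def extensional_def)
      with that show False by simp
    qed
    have "(\<integral>\<^sup>+\<kappa>. ?f (x, \<kappa>) \<partial>count_space ?K) =
        path_weight N x * (\<integral>\<^sup>+\<kappa>. ennreal (pmf (letters_pmf N x) \<kappa>) * F x \<kappa> \<partial>count_space ?K)"
      by (simp add: nn_integral_cmult[symmetric] mult_ac)
    also have "(\<integral>\<^sup>+\<kappa>. ennreal (pmf (letters_pmf N x) \<kappa>) * F x \<kappa> \<partial>count_space ?K) =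
        (\<integral>\<^sup>+\<kappa>. ennreal (pmf (letters_pmf N x) \<kappa>) * F x \<kappa> \<partial>count_space UNIV)"
    proof (subst nn_integral_count_space_indicator, simp, rule nn_integral_cong)
      fix \<kappa>
      show "ennreal (pmf (letters_pmf N x) \<kappa>) * F x \<kappa> * indicator ?K \<kappa> =
          ennreal (pmf (letters_pmf N x) \<kappa>) * F x \<kappa>"
        using supp[of \<kappa>] by (cases "\<kappa> \<in> ?K") (simp_all only: indicator_simps, simp_all)
    qed
    finally show "(\<integral>\<^sup>+\<kappa>. ?f (x, \<kappa>) \<partial>count_space ?K) =
        path_weight N x * (\<integral>\<^sup>+\<kappa>. F x \<kappa> \<partial>letters_pmf N x)"
      by (simp add: nn_integral_measure_pmf)
  qed
  finally show ?thesis .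
qed

text \<open>Any predicate \<open>Q\<close> of the trajectory defines an event, because every subset
  of the countable target is measurable.\<close>

lemma prob_eq_nn_integral_trajectory:
  "ennreal (\<P>(w in M. Q (trajectory N w))) = (\<integral>\<^sup>+w. of_bool (Q (trajectory N w)) \<partial>M)"
proof -
  have "trajectory N w \<in> letter_paths N \<times> ({1..N} \<rightarrow>\<^sub>E {1..})" if "w \<in> space M" for w
    using measurable_space[OF measurable_trajectory that] by simp
  then have "{w \<in> space M. Q (trajectory N w)} =
      trajectory N -` (Collect Q \<inter> (letter_paths N \<times> ({1..N} \<rightarrow>\<^sub>E {1..}))) \<inter> space M"
    by auto
  also have "\<dots> \<in> events"
    by (intro measurable_sets[OF measurable_trajectory]) auto
  finally have "emeasure M {w \<in> space M. Q (trajectory N w)} =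
      (\<integral>\<^sup>+w. indicator {w \<in> space M. Q (trajectory N w)} w \<partial>M)"
    by simp
  also have "\<dots> = (\<integral>\<^sup>+w. of_bool (Q (trajectory N w)) \<partial>M)"
    by (intro nn_integral_cong) (auto split: split_indicator)
  finally show ?thesis
    by (simp add: emeasure_eq_measure)
qed

lemma nn_integral_path:
  "(\<integral>\<^sup>+w. F (fst (trajectory N w)) \<partial>M) =
    (\<integral>\<^sup>+x. path_weight N x * F x \<partial>count_space (letter_paths N))"
  using nn_integral_trajectory[of "\<lambda>x \<kappa>. F x" N] by (simp add: measure_pmf.emeasure_space_1)

section \<open>The bound for a fixed \<epsilon>\<close>

text \<open>Both sides are written as sums over letter paths of length n + 1, weighted by
  \<open>path_weight\<close>. It then suffices to bound the conditional probability path by path and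
  to sum the three terms separately.\<close>

lemma prob_occurrences_bound:
  assumes \<epsilon>: "0 \<le> \<epsilon>" "\<epsilon> \<le> 1"
  shows "ennreal (\<P>(w in M. occurrences Z n w = r)) \<le>
      ennreal (\<P>(w in M. occurrences (underlying Z) n w = r)) *
        (SUP a\<in>A. \<Sum>k. ennreal (pmf (P a) (Suc k) ^ (1 + r))) +
      (a_term M P (underlying Z) n r \<epsilon> + b_term M P (underlying Z) n r \<epsilon>)"
proof -
  define s where "s = (SUP a\<in>A. \<Sum>k. ennreal (pmf (P a) (Suc k) ^ (1 + r)))"
  \<comment> \<open>With evaluation maps as the process, \<open>occurrences\<close> computes the
    count directly from a letter path.\<close>
  define L :: "(nat \<Rightarrow> 'a) \<Rightarrow> nat" where "L = occurrences (\<lambda>i y. y i) n"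
  let ?X = "\<lambda>w. fst (trajectory (n + 1) w)"
  let ?q = "path_weight (n + 1)"
  let ?S = "count_space (letter_paths (n + 1))"
  define D where "D x \<kappa> = (\<Sum>i = 1..n. of_bool (x i = x (n + 1) \<and> \<kappa> i = \<kappa> (n + 1)) :: nat)"
    for x :: "nat \<Rightarrow> 'a" and \<kappa> :: "nat \<Rightarrow> nat"
  \<comment> \<open>The conditional probability of r matches given the letter path
    \<open>x\<close>.\<close>
  define h where "h x = (\<Sum>k. ennreal (real (L x choose r) * pmf (P (x (n + 1))) (Suc k) ^ (1 + r) *
      (1 - pmf (P (x (n + 1))) (Suc k)) ^ (L x - r)))" for x
  define \<alpha> where "\<alpha> x = of_bool (r < L x) * (counting_function P (x (n + 1)) \<epsilon> / of_nat (L x))" for x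
  define \<beta> where "\<beta> u x = of_bool (r < L x) * counting_function P (x (n + 1)) (u / 2) *
      of_nat (L x choose r) * ennreal ((1 - u / 2) ^ (L x - r))" for u x
  have Z: "occurrences Z n w = D (?X w) (snd (trajectory (n + 1) w))" for w
    unfolding occurrences_def D_def trajectory_def
    by (intro sum.cong) (auto simp: prod_eq_iff)
  have X: "occurrences (underlying Z) n w = L (?X w)" "underlying Z (n + 1) w = ?X w (n + 1)" for w
    unfolding L_def occurrences_def trajectory_def underlying_def
    by (auto intro!: sum.cong)
  \<comment> \<open>Measurability in the threshold, for the interchange of the integral over
    \<open>u\<close> with the sum over paths.\<close>
  have [measurable]: "counting_function P a \<in> borel_measurable borel" for a
    unfolding counting_function_def by measurable

  have "ennreal (\<P>(w in M. occurrences Z n w = r)) =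
      (\<integral>\<^sup>+w. of_bool (D (?X w) (snd (trajectory (n + 1) w)) = r) \<partial>M)"
    unfolding Z by (rule prob_eq_nn_integral_trajectory)
  also have "\<dots> = (\<integral>\<^sup>+x. ?q x * (\<integral>\<^sup>+\<kappa>. of_bool (D x \<kappa> = r) \<partial>letters_pmf (n + 1) x) \<partial>?S)"
    by (rule nn_integral_trajectory)
  also have "\<dots> = (\<integral>\<^sup>+x. ?q x * h x \<partial>?S)"
  proof (rule nn_integral_cong)
    fix x assume "x \<in> space ?S"
    then have "x (n + 1) \<in> A"
      by (auto simp: letter_paths_def)
    then have "pmf (P (x (n + 1))) 0 = 0"
      using letter_support by (fastforce simp: set_pmf_iff)
    then show "?q x * (\<integral>\<^sup>+\<kappa>. of_bool (D x \<kappa> = r) \<partial>letters_pmf (n + 1) x) = ?q x * h x"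
      unfolding D_def h_def by (subst nn_integral_Pi_pmf_occurrences[of "L x"]) (auto simp: L_def)
  qed
  also have "\<dots> \<le> (\<integral>\<^sup>+x. ?q x * of_bool (L x = r) * s + (ennreal (c_const r) * (?q x * \<alpha> x) +
      2 ^ (1 + r) * (\<integral>\<^sup>+u\<in>{0..\<epsilon>}. ennreal (u ^ r) * (?q x * \<beta> u x) \<partial>lborel)) \<partial>?S)"
  proof (rule nn_integral_mono)
    fix x assume "x \<in> space ?S"
    then have xA: "x (n + 1) \<in> A"
      by (auto simp: letter_paths_def)
    have "h x \<le> of_bool (L x = r) * s + (ennreal (c_const r) * \<alpha> x +
      2 ^ (1 + r) * (\<integral>\<^sup>+u\<in>{0..\<epsilon>}. ennreal (u ^ r) * \<beta> u x \<partial>lborel))"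
    proof (cases "L x" r rule: linorder_cases)
      case less
      then show ?thesis by (simp add: h_def binomial_eq_0)
    next
      case equal
      have "h x \<le> s"
        unfolding s_def h_def using equal xA by (intro SUP_upper2[of "x (n + 1)"]) auto
      with equal show ?thesis
        by (simp add: add_increasing2)
    next
      case greater
      then show ?thesis
        using suminf_binomial_weight_le[OF greater \<epsilon>, of P "x (n + 1)"] by (simp add: h_def \<alpha>_def \<beta>_def)
    qed
    then have "?q x * h x \<le> ?q x * (of_bool (L x = r) * s + (ennreal (c_const r) * \<alpha> x +
      2 ^ (1 + r) * (\<integral>\<^sup>+u\<in>{0..\<epsilon>}. ennreal (u ^ r) * \<beta> u x \<partial>lborel)))"
      by (rule mult_left_mono) simp
    also have "\<dots> = ?q x * of_bool (L x = r) * s + (ennreal (c_const r) * (?q x * \<alpha> x) +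
      2 ^ (1 + r) * (?q x * (\<integral>\<^sup>+u\<in>{0..\<epsilon>}. ennreal (u ^ r) * \<beta> u x \<partial>lborel)))"
      by (simp only: distrib_left mult_ac)
    also have "?q x * (\<integral>\<^sup>+u\<in>{0..\<epsilon>}. ennreal (u ^ r) * \<beta> u x \<partial>lborel) =
        (\<integral>\<^sup>+u. ?q x * (ennreal (u ^ r) * \<beta> u x * indicator {0..\<epsilon>} u) \<partial>lborel)"
      by (rule nn_integral_cmult[symmetric]) (simp add: \<beta>_def)
    also have "\<dots> = (\<integral>\<^sup>+u\<in>{0..\<epsilon>}. ennreal (u ^ r) * (?q x * \<beta> u x) \<partial>lborel)"
      by (simp only: mult_ac)
    finally show "?q x * h x \<le> ?q x * of_bool (L x = r) * s + (ennreal (c_const r) * (?q x * \<alpha> x) +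
      2 ^ (1 + r) * (\<integral>\<^sup>+u\<in>{0..\<epsilon>}. ennreal (u ^ r) * (?q x * \<beta> u x) \<partial>lborel))" .
  qed
  also have "\<dots> = (\<integral>\<^sup>+x. ?q x * of_bool (L x = r) \<partial>?S) * s + (ennreal (c_const r) * (\<integral>\<^sup>+x. ?q x * \<alpha> x \<partial>?S) +
      2 ^ (1 + r) * (\<integral>\<^sup>+x. (\<integral>\<^sup>+u\<in>{0..\<epsilon>}. ennreal (u ^ r) * (?q x * \<beta> u x) \<partial>lborel) \<partial>?S))"
    by (simp add: nn_integral_add nn_integral_cmult nn_integral_multc)
  \<comment> \<open>Tonelli for the countable sum over paths, which brings the expectation inside
    the integral over \<open>u\<close> as in \<open>b_term\<close>.\<close>
  also have "(\<integral>\<^sup>+x. (\<integral>\<^sup>+u\<in>{0..\<epsilon>}. ennreal (u ^ r) * (?q x * \<beta> u x) \<partial>lborel) \<partial>?S) =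
      (\<integral>\<^sup>+u. \<integral>\<^sup>+x. ennreal (u ^ r) * (?q x * \<beta> u x) * indicator {0..\<epsilon>} u \<partial>?S \<partial>lborel)"
    by (rule nn_integral_count_space_nn_integral[symmetric]) (auto simp: countable_letter_paths \<beta>_def)
  also have "\<dots> = (\<integral>\<^sup>+u\<in>{0..\<epsilon>}. ennreal (u ^ r) * (\<integral>\<^sup>+x. ?q x * \<beta> u x \<partial>?S) \<partial>lborel)"
    by (simp add: nn_integral_cmult nn_integral_multc)
  \<comment> \<open>From here on the path sums are turned back into a probability and expectations
    under \<open>M\<close>.\<close>
  also have "(\<integral>\<^sup>+x. ?q x * of_bool (L x = r) \<partial>?S) = ennreal (\<P>(w in M. occurrences (underlying Z) n w = r))"
    unfolding X prob_eq_nn_integral_trajectory[of "\<lambda>t. L (fst t) = r"] by (rule nn_integral_path[symmetric])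
  also have "ennreal (c_const r) * (\<integral>\<^sup>+x. ?q x * \<alpha> x \<partial>?S) = a_term M P (underlying Z) n r \<epsilon>"
    unfolding a_term_def X nn_integral_path[symmetric] \<alpha>_def ..
  also have "2 ^ (1 + r) * (\<integral>\<^sup>+u\<in>{0..\<epsilon>}. ennreal (u ^ r) * (\<integral>\<^sup>+x. ?q x * \<beta> u x \<partial>?S) \<partial>lborel) =
      b_term M P (underlying Z) n r \<epsilon>"
    unfolding b_term_def X nn_integral_path[symmetric] \<beta>_def ..
  finally show ?thesis
    unfolding s_def .
qed

end

section \<open>The infimum over \<epsilon>\<close>

theorem theorem4p1:
  fixes M :: "'w measure"
    and A :: "'a set"
    and P :: "'a \<Rightarrow> nat pmf"
    and R :: "'a list \<Rightarrow> 'a pmf"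
    and Z :: "nat \<Rightarrow> 'w \<Rightarrow> 'a \<times> nat"
    and n r :: nat
  assumes "regime_switching_process M A P R Z"
    and "1 \<le> n"
    and "r \<le> n - 1"
  shows "ennreal (\<P>(w in M. occurrences Z n w = r)) \<le>
      ennreal (\<P>(w in M. occurrences (underlying Z) n w = r)) *
        (SUP a\<in>A. \<Sum>k. ennreal (pmf (P a) (Suc k) ^ (1 + r))) +
      (INF \<epsilon>\<in>{0..1}. a_term M P (underlying Z) n r \<epsilon> + b_term M P (underlying Z) n r \<epsilon>)"
proof -
  interpret regime_switching_process M A P R Z by fact
  \<comment> \<open>The term free of \<epsilon> is moved to the left, so that
    \<open>INF_greatest\<close> applies to the remaining terms. Truncated subtraction does no harm,
    since the probability on the left is finite.\<close>
  have "ennreal (\<P>(w in M. occurrences Z n w = r)) -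
      ennreal (\<P>(w in M. occurrences (underlying Z) n w = r)) *
        (SUP a\<in>A. \<Sum>k. ennreal (pmf (P a) (Suc k) ^ (1 + r))) \<le>
      (INF \<epsilon>\<in>{0..1}. a_term M P (underlying Z) n r \<epsilon> + b_term M P (underlying Z) n r \<epsilon>)"
    using prob_occurrences_bound by (intro INF_greatest) (auto simp: ennreal_minus_le_iff)
  then show ?thesis
    by (simp add: ennreal_minus_le_iff)
qed

end
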